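(* Let $a\in\{1,2\}$, let $b$ be a positive integer coprime to $a$, and put $m=2b/a$. Let $c_1<c_2<c_3<\cdots$ be the sequence of all $(a,b)$ cobalancing numbers listed in increasing order. Then this sequence is described by the recurrence $$c_n=(2m+2)\,c_{n-1}-c_{n-2}+m\qquad (n\ge 3),$$ with initial terms $c_1=m$ and $c_2=2m^2+3m$.
   Context: For coprime positive integers $a,b$, an $(a,b)$ cobalancing number is a positive integer $n$ such that $$a\left(1+2+\cdots+n\right)=b\left((n+1)+(n+2)+\cdots+(n+r)\right)$$ for some positive integer $r$; this $r$ is called the cobalancer of $n$. *)

theory Defs
  imports Complex_Main "HOL-Library.Infinite_Set"
begin

definition is_cobalancer :: "nat \<Rightarrow> nat \<Rightarrow> nat \<Rightarrow> nat \<Rightarrow> bool" where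
  "is_cobalancer a b n r \<longleftrightarrow>
     0 < r \<and> a * (\<Sum>i = 1..n. i) = b * (\<Sum>i = n + 1..n + r. i)"

text \<open>The parameters \<open>a\<close> and \<open>b\<close> are meant to be positive and coprime; this is not built into
  the definitions and has to be assumed where they are used.\<close>

definition cobalancing :: "nat \<Rightarrow> nat \<Rightarrow> nat \<Rightarrow> bool" where
  "cobalancing a b n \<longleftrightarrow> 0 < n \<and> (\<exists>r. is_cobalancer a b n r)"

text \<open>The \<open>n\<close>-th \<open>(a, b)\<close> cobalancing number in increasing order, indexed from 1 (the index 0
  carries no meaning). Since \<^const>\<open>enumerate\<close> is indexed from 0, the argument is shifted.
  \<^const>\<open>enumerate\<close> lists a set in increasing order without repetition only if the set is
  infinite, so infinitude must be established separately.\<close>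

definition cobalancing_seq :: "nat \<Rightarrow> nat \<Rightarrow> nat \<Rightarrow> nat" where
  "cobalancing_seq a b n = enumerate {k. cobalancing a b k} (n - 1)"

end

theory Submission
  imports Defs
begin

text \<open>With \<open>m = 2 b / a\<close> and \<open>N = n + r\<close>, being a cobalancing number means
  \<open>(m + 2) n (n + 1) = m N (N + 1)\<close>, that is \<open>(m + 2) x\<^sup>2 - m y\<^sup>2 = 2\<close> for \<open>x = 2 n + 1\<close>, \<open>y = 2 N + 1\<close>.
  Multiplication by the unit \<open>m + 1 + sqrt (m (m + 2))\<close> acts on the natural solutions \<open>(n, N)\<close>, and
  its inverse decreases \<open>n\<close> while keeping both entries nonnegative, so every solution lies in the
  orbit of \<open>(0, 0)\<close>. Along this orbit \<open>n\<close> increases and satisfies the recurrence.\<close>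

text \<open>In the coordinates x = 2 n + 1, y = 2 N + 1 this is the linear map (x, y) -> ((m + 1) x
  + m y, (m + 2) x + (m + 1) y) of determinant 1; the constant terms come from the change of
  coordinates.\<close>

definition pell_step :: "nat \<Rightarrow> nat \<times> nat \<Rightarrow> nat \<times> nat" where
  "pell_step m = (\<lambda>(n, N). ((m + 1) * n + m * N + m, (m + 2) * n + (m + 1) * N + m + 1))"

definition pell_orbit :: "nat \<Rightarrow> nat \<Rightarrow> nat \<times> nat" where
  "pell_orbit m k = (pell_step m ^^ k) (0, 0)"

lemma pell_orbit_0 [simp]: "pell_orbit m 0 = (0, 0)"
  by (simp add: pell_orbit_def)

lemma pell_orbit_Suc [simp]: "pell_orbit m (Suc k) = pell_step m (pell_orbit m k)"
  by (simp add: pell_orbit_def)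

lemma pell_orbit_solution:
  assumes "pell_orbit m k = (n, N)"
  shows "(m + 2) * (n * (n + 1)) = m * (N * (N + 1))"
  using assms
proof (induction k arbitrary: n N)
  case (Suc k)
  obtain p q where pq: "pell_orbit m k = (p, q)"
    by fastforce
  have "n = (m + 1) * p + m * q + m" "N = (m + 2) * p + (m + 1) * q + m + 1"
    using Suc.prems pq by (simp_all add: pell_step_def)
  with Suc.IH[OF pq] show ?case
    by algebra
qed simp

text \<open>The inverse step sends (n, N) to p = (m + 1) n - m N and q = (m + 1) N - (m + 2) n - 1.
  The last two bounds say that p and q are nonnegative, and the first one yields p < n. Over the
  integers the differences are not truncated.\<close>

lemma pell_descent:
  fixes m n N :: int
  assumes "0 < m" "0 < n" "0 \<le> N" and eq: "(m + 2) * (n * (n + 1)) = m * (N * (N + 1))"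
  shows "n < N" "m * N \<le> (m + 1) * n" "(m + 2) * n < (m + 1) * N"
proof -
  show less: "n < N"
  proof (rule ccontr)
    assume "\<not> n < N"
    then have "m * (N * (N + 1)) \<le> m * (n * (n + 1))"
      using assms by (intro mult_left_mono mult_mono) auto
    also have "\<dots> < (m + 2) * (n * (n + 1))"
      using \<open>0 < n\<close> by (intro mult_strict_right_mono) auto
    finally show False
      using eq by simp
  qed
  show "m * N \<le> (m + 1) * n"
  proof (rule ccontr)
    assume "\<not> m * N \<le> (m + 1) * n"
    \<comment> \<open>Integrality gives (m + 1) n + 1 \<le> m N. Multiplying this by itself shifted
      by m turns the right side into m times a side of \<open>eq\<close>.\<close>
    then have "((m + 1) * n + 1) * ((m + 1) * n + 1 + m) \<le> (m * N) * (m * N + m)"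
      using assms by (intro mult_mono) auto
    also have "\<dots> = m * (m * (N * (N + 1)))"
      by algebra
    also have "\<dots> = m * ((m + 2) * (n * (n + 1)))"
      using eq by simp
    also have "\<dots> = ((m + 1) * n + 1) * ((m + 1) * n + 1 + m) - (n * n + n) - (m + 1) * (n + 1)"
      by algebra
    finally have "n * n + n + (m + 1) * (n + 1) \<le> 0"
      by simp
    moreover have "0 \<le> n * n" "0 < (m + 1) * (n + 1)"
      using assms by simp_all
    ultimately show False
      using \<open>0 < n\<close> by linarith
  qed
  show "(m + 2) * n < (m + 1) * N"
  proof (rule ccontr)
    assume "\<not> (m + 2) * n < (m + 1) * N"
    then have le: "(m + 1) * N \<le> (m + 2) * n"
      by simp
    \<comment> \<open>The shifts make the products (m + 1)^2 N (N + 1) and (m + 2)^2 n (n + 1), so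
      that \<open>eq\<close> and (m + 1)^2 = m (m + 2) + 1 leave only N (N + 1) \<le> 0.\<close>
    then have "(m + 1) * N + (m + 1) \<le> (m + 2) * n + (m + 2)"
      by linarith
    with le have "((m + 1) * N) * ((m + 1) * N + (m + 1)) \<le> ((m + 2) * n) * ((m + 2) * n + (m + 2))"
      by (rule mult_mono) (use assms(1-3) in simp_all)
    also have "\<dots> = (m + 2) * ((m + 2) * (n * (n + 1)))"
      by algebra
    also have "\<dots> = (m + 2) * (m * (N * (N + 1)))"
      using eq by simp
    also have "\<dots> = ((m + 1) * N) * ((m + 1) * N + (m + 1)) - N * (N + 1)"
      by algebra
    finally have "N * (N + 1) \<le> 0"
      by simp
    moreover have "0 < N * (N + 1)"
      using less \<open>0 < n\<close> by simp
    ultimately show False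
      by simp
  qed
qed

lemma solution_in_pell_orbit:
  assumes "0 < m" "(m + 2) * (n * (n + 1)) = m * (N * (N + 1))"
  shows "\<exists>k. pell_orbit m k = (n, N)"
  using assms(2)
proof (induction n arbitrary: N rule: less_induct)
  case (less n)
  show ?case
  proof (cases "n = 0")
    case True
    then have "pell_orbit m 0 = (n, N)"
      using less.prems \<open>0 < m\<close> by simp
    then show ?thesis ..
  next
    case False
    have "int ((m + 2) * (n * (n + 1))) = int (m * (N * (N + 1)))"
      using less.prems by simp
    then have eq: "(int m + 2) * (int n * (int n + 1)) = int m * (int N * (int N + 1))"
      by (simp only: of_nat_mult of_nat_add of_nat_numeral of_nat_1)
    note descent = pell_descent[OF _ _ _ eq]
    \<comment> \<open>The preimage of (n, N) under \<open>pell_step\<close>; by the descent bounds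
      \<open>nat\<close> truncates nothing.\<close>
    define p q where "p = nat ((int m + 1) * int n - int m * int N)"
      and "q = nat ((int m + 1) * int N - (int m + 2) * int n - 1)"
    have p: "int p = (int m + 1) * int n - int m * int N"
      and q: "int q = (int m + 1) * int N - (int m + 2) * int n - 1"
      using descent(2,3) False \<open>0 < m\<close> by (simp_all add: p_def q_def)
    \<comment> \<open>From n + 1 \<le> N follows p \<le> n - m.\<close>
    have "int m * (int n + 1) \<le> int m * int N"
      using descent(1) False \<open>0 < m\<close> by (intro mult_left_mono) auto
    then have "int p < int n"
      using p \<open>0 < m\<close> by (simp add: algebra_simps)
    then have "p < n"
      by simp
    moreover have "(m + 2) * (p * (p + 1)) = m * (q * (q + 1))"
    proof -
      have "(int m + 2) * (int p * (int p + 1)) = int m * (int q * (int q + 1))"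
        using p q eq by algebra
      then have "int ((m + 2) * (p * (p + 1))) = int (m * (q * (q + 1)))"
        by (simp only: of_nat_mult of_nat_add of_nat_numeral of_nat_1)
      then show ?thesis
        by (simp only: of_nat_eq_iff)
    qed
    ultimately obtain k where k: "pell_orbit m k = (p, q)"
      using less.IH by blast
    have "int n = (int m + 1) * int p + int m * int q + int m"
      "int N = (int m + 2) * int p + (int m + 1) * int q + int m + 1"
      using p q by algebra+
    then have "int n = int ((m + 1) * p + m * q + m)"
      "int N = int ((m + 2) * p + (m + 1) * q + m + 1)"
      by (simp_all only: of_nat_mult of_nat_add of_nat_numeral of_nat_1)
    then have "pell_orbit m (Suc k) = (n, N)"
      using k by (simp only: of_nat_eq_iff pell_orbit_Suc) (simp add: pell_step_def)
    then show ?thesis ..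
  qed
qed

lemma strict_mono_fst_pell_orbit:
  assumes "0 < m"
  shows "strict_mono (\<lambda>k. fst (pell_orbit m k))"
  using assms by (auto simp: strict_mono_Suc_iff pell_step_def split: prod.split)

text \<open>Cayley-Hamilton for a matrix of trace 2 m + 2 and determinant 1, with x = 2 n + 1
  substituted. The sum on the left avoids truncated subtraction.\<close>

lemma fst_pell_orbit_recurrence:
  "fst (pell_orbit m (Suc (Suc k))) + fst (pell_orbit m k)
    = (2 * m + 2) * fst (pell_orbit m (Suc k)) + m"
  by (cases "pell_orbit m k") (simp add: pell_step_def algebra_simps)

text \<open>Adding b (1 + ... + n) to both sides completes the right sum to one starting at 1; then
  both sums have Gauss's closed form.\<close>

lemma is_cobalancer_iff:
  "is_cobalancer a b n r \<longleftrightarrow>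
    0 < r \<and> (a + b) * (n * (n + 1)) = b * ((n + r) * (n + r + 1))"
proof -
  have gauss: "2 * (\<Sum>i = 1..k. i) = k * (k + 1)" for k :: nat
    by (induction k) auto
  have split: "(\<Sum>i = 1..n + r. i) = (\<Sum>i = 1..n. i) + (\<Sum>i = n + 1..n + r. i)"
    using sum.ub_add_nat[of 1 n "\<lambda>i. i" r] by simp
  have "a * (\<Sum>i = 1..n. i) = b * (\<Sum>i = n + 1..n + r. i) \<longleftrightarrow>
      (a + b) * (2 * (\<Sum>i = 1..n. i)) = b * (2 * (\<Sum>i = 1..n + r. i))"
    unfolding split by (simp add: algebra_simps)
  then show ?thesis
    unfolding is_cobalancer_def gauss by simp
qed

lemma cobalancing_iff_solution:
  assumes "0 < a" "0 < b" "a * m = 2 * b"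
  shows "cobalancing a b n \<longleftrightarrow>
    0 < n \<and> (\<exists>N. (m + 2) * (n * (n + 1)) = m * (N * (N + 1)))"
proof -
  have "0 < m"
    using assms by (cases m) auto
  \<comment> \<open>After doubling, 2 (a + b) = a (m + 2) and 2 b = a m, and the factor a
    cancels.\<close>
  have scale: "(a + b) * s = b * t \<longleftrightarrow> (m + 2) * s = m * t" for s t
  proof -
    have "(a + b) * s = b * t \<longleftrightarrow> 2 * ((a + b) * s) = 2 * (b * t)"
      by simp
    also have "2 * ((a + b) * s) = a * ((m + 2) * s)"
      using assms(3) by algebra
    also have "2 * (b * t) = a * (m * t)"
      using assms(3) by algebra
    finally show ?thesis
      using \<open>0 < a\<close> by simp
  qed
  \<comment> \<open>This makes r = N - n a positive cobalancer for every solution with n >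
    0.\<close>
  have "n < N" if "0 < n" "(m + 2) * (n * (n + 1)) = m * (N * (N + 1))" for N
  proof -
    have "int ((m + 2) * (n * (n + 1))) = int (m * (N * (N + 1)))"
      using that by simp
    then have "(int m + 2) * (int n * (int n + 1)) = int m * (int N * (int N + 1))"
      by (simp only: of_nat_mult of_nat_add of_nat_numeral of_nat_1)
    from pell_descent(1)[OF _ _ _ this] show ?thesis
      using \<open>0 < m\<close> \<open>0 < n\<close> by simp
  qed
  then have "(\<exists>r > 0. (m + 2) * (n * (n + 1)) = m * ((n + r) * (n + r + 1))) \<longleftrightarrow>
      (\<exists>N. (m + 2) * (n * (n + 1)) = m * (N * (N + 1)))" if "0 < n"
    using that less_imp_add_positive[of n] by blast
  then show ?thesis
    unfolding cobalancing_def is_cobalancer_iff scale by blast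
qed

text \<open>The orbit is taken from index 1 because its start (0, 0) has n = 0, which is not a
  cobalancing number.\<close>

lemma cobalancing_set_eq:
  assumes "0 < a" "0 < b" "a * m = 2 * b"
  shows "{n. cobalancing a b n} = range (\<lambda>k. fst (pell_orbit m (Suc k)))"
proof -
  have "0 < m"
    using assms by (cases m) auto
  have "cobalancing a b n \<longleftrightarrow> (\<exists>k. n = fst (pell_orbit m (Suc k)))" for n
  proof
    assume "cobalancing a b n"
    then obtain N where "0 < n" "(m + 2) * (n * (n + 1)) = m * (N * (N + 1))"
      unfolding cobalancing_iff_solution[OF assms] by blast
    then obtain k where k: "pell_orbit m k = (n, N)"
      using solution_in_pell_orbit \<open>0 < m\<close> by blast
    then show "\<exists>k. n = fst (pell_orbit m (Suc k))"
      using \<open>0 < n\<close> by (cases k) (auto simp del: pell_orbit_Suc, metis fst_conv)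
  next
    assume "\<exists>k. n = fst (pell_orbit m (Suc k))"
    then obtain k N where k: "pell_orbit m (Suc k) = (n, N)"
      by (metis prod.collapse)
    then have "0 < n"
      using \<open>0 < m\<close> by (auto simp: pell_step_def split: prod.splits)
    with pell_orbit_solution[OF k] show "cobalancing a b n"
      unfolding cobalancing_iff_solution[OF assms] by blast
  qed
  then show ?thesis
    by auto
qed

lemma strict_mono_range_unique:
  fixes f g :: "nat \<Rightarrow> 'a :: linorder"
  assumes "strict_mono f" "strict_mono g" "range f = range g"
  shows "f = g"
proof
  fix k
  show "f k = g k"
  proof (induction k rule: less_induct)
    case (less k)
    \<comment> \<open>If u k < v k, then v takes the value u k at some j < k, where u and v agree;
      so u repeats a value. Stated for generic u and v to serve both orders.\<close>
    have no_less: "\<not> u k < v k"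
      if "strict_mono u" "strict_mono v" "range u = range v" "\<And>j. j < k \<Longrightarrow> u j = v j"
      for u v :: "nat \<Rightarrow> 'a"
    proof
      assume "u k < v k"
      obtain j where j: "u k = v j"
        using \<open>range u = range v\<close> by (metis rangeE rangeI)
      with \<open>u k < v k\<close> have "j < k"
        using \<open>strict_mono v\<close> by (simp add: strict_mono_less)
      with that(4) j have "u k = u j"
        by simp
      with \<open>j < k\<close> \<open>strict_mono u\<close> show False
        by (simp add: strict_mono_eq)
    qed
    show ?case
      using no_less[of f g] no_less[of g f] assms less by force
  qed
qed

lemma enumerate_range_strict_mono:
  fixes f :: "nat \<Rightarrow> nat"
  assumes "strict_mono f"
  shows "enumerate (range f) = f"
proof -
  have "infinite (range f)"
    using assms by (intro range_inj_infinite strict_mono_imp_inj_on)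
  then show ?thesis
    using assms by (intro strict_mono_range_unique strict_mono_enumerate range_enumerate)
qed

theorem theorem1p4:
  fixes a b :: nat and m :: real
  assumes "a \<in> {1, 2}" and "0 < b" and "coprime a b"
    and "m = 2 * real b / real a"
  shows "infinite {k. cobalancing a b k}
    \<and> real (cobalancing_seq a b 1) = m
    \<and> real (cobalancing_seq a b 2) = 2 * m ^ 2 + 3 * m
    \<and> (\<forall>n \<ge> 3. real (cobalancing_seq a b n)
          = (2 * m + 2) * real (cobalancing_seq a b (n - 1))
            - real (cobalancing_seq a b (n - 2)) + m)"
proof -
  \<comment> \<open>As a divides 2, the real m is a natural number k, the parameter of the
    orbit.\<close>
  obtain k where k: "a * k = 2 * b"
    using \<open>a \<in> {1, 2}\<close> by auto
  have "0 < a"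
    using \<open>a \<in> {1, 2}\<close> by auto
  have "0 < k"
    using k \<open>0 < b\<close> by (cases k) auto
  have "real a * real k = 2 * real b"
    using arg_cong[OF k, of real] by simp
  then have m: "m = real k"
    using assms(4) \<open>0 < a\<close> by (metis nonzero_mult_div_cancel_left of_nat_0_eq_iff less_numeral_extra(3))
  define f where "f = (\<lambda>i. fst (pell_orbit k (Suc i)))"
  have "strict_mono f"
    using strict_mono_fst_pell_orbit[OF \<open>0 < k\<close>]
    by (simp add: f_def strict_mono_def del: pell_orbit_Suc)
  have set_eq: "{n. cobalancing a b n} = range f"
    unfolding f_def by (rule cobalancing_set_eq[OF \<open>0 < a\<close> \<open>0 < b\<close> k])
  have seq: "cobalancing_seq a b n = f (n - 1)" for n
    unfolding cobalancing_seq_def set_eq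
    by (simp add: enumerate_range_strict_mono[OF \<open>strict_mono f\<close>])
  have rec: "real (f (Suc (Suc i))) = (2 * m + 2) * real (f (Suc i)) - real (f i) + m" for i
    using arg_cong[OF fst_pell_orbit_recurrence[of k "Suc i"], of real]
    unfolding f_def m by (simp add: algebra_simps del: pell_orbit_Suc)
  show ?thesis
  proof (intro conjI allI impI)
    show "infinite {k. cobalancing a b k}"
      unfolding set_eq
      using \<open>strict_mono f\<close> by (intro range_inj_infinite strict_mono_imp_inj_on)
    show "real (cobalancing_seq a b 1) = m"
      by (simp add: seq f_def pell_step_def m)
    show "real (cobalancing_seq a b 2) = 2 * m ^ 2 + 3 * m"
      by (simp add: seq f_def pell_step_def m algebra_simps power2_eq_square)
    show "real (cobalancing_seq a b n) = (2 * m + 2) * real (cobalancing_seq a b (n - 1))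
        - real (cobalancing_seq a b (n - 2)) + m" if "3 \<le> n" for n
    proof -
      \<comment> \<open>Exposing three successors resolves the truncated n - 1 and n - 2, and the
        shift by one in \<open>seq\<close>, to the indices in \<open>rec\<close>.\<close>
      have n: "n = Suc (Suc (Suc (n - 3)))"
        using \<open>3 \<le> n\<close> by simp
      show ?thesis
        using rec[of "n - 3"] by (subst (1 2 3) n) (simp add: seq)
    qed
  qed
qed

end
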